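(* Let $\mathcal{F}$ be a finite family of convex sets in $\mathbb{R}^2$, and let $\mathcal{M}$ be a matroid with ground set $\mathcal{F}$, rank $6$ and rank function $r$. If every $3$ sets of $\mathcal{F}$ whose set has rank $3$ in $\mathcal{M}$ can be pierced by a line, then there are $3$ lines whose union intersects every member of some subfamily $\mathcal{F}'\subseteq\mathcal{F}$ with $r(\mathcal{F}\setminus\mathcal{F}')\le 5$.
   Context: A family of sets is pierced by a line if the line intersects every member of the family. The rank function $r$ of a matroid assigns to a subset of the ground set the size of a largest independent set contained in it. *)

theory Defs
  imports "HOL-Analysis.Analysis"
begin

locale matroid =
  fixes carrier :: "'a set" and indep :: "'a set \<Rightarrow> bool"
  assumes carrier_finite: "finite carrier"
    and indep_subset_carrier: "indep X \<Longrightarrow> X \<subseteq> carrier"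
    and indep_empty: "indep {}"
    and indep_subset: "indep X \<Longrightarrow> Y \<subseteq> X \<Longrightarrow> indep Y"
    and augment: "indep X \<Longrightarrow> indep Y \<Longrightarrow> card X < card Y \<Longrightarrow>
      \<exists>y \<in> Y - X. indep (insert y X)"

definition matroid_rank :: "('a set \<Rightarrow> bool) \<Rightarrow> 'a set \<Rightarrow> nat" where
  "matroid_rank indep A = Max (card ` {X. X \<subseteq> A \<and> indep X})"

definition is_line :: "'a::euclidean_space set \<Rightarrow> bool" where
  "is_line L \<longleftrightarrow> affine L \<and> aff_dim L = 1"

definition pierces :: "'a set \<Rightarrow> 'a set set \<Rightarrow> bool" where
  "pierces L \<F> \<longleftrightarrow> (\<forall>C\<in>\<F>. L \<inter> C \<noteq> {})"

end

theory Submission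
  imports Defs
begin

text \<open>
  A point \<open>x\<close> of the 5-simplex cuts a large circle into six arcs of lengths proportional to its
  coordinates; joining opposite endpoints of the arcs gives three lines. For each arc, the two
  chords leaving its endpoints bound a wedge containing the arc. A convex set that misses all three
  lines lies in one of the six wedges, and the wedge of an arc of length 0 is empty. If the sets
  missed by the three lines had full rank for every \<open>x\<close>, a matroid version of the KKM theorem
  (Brouwer's theorem for a weighted average over the bases, followed by Rado's theorem) would give
  an \<open>x\<close> and an independent family of six sets, one in each wedge. The three lines bound at most one
  triangle, so for one of the two alternating triples of wedges the triangle lies in none of them;
  a line cannot meet all three wedges of that triple, since it crosses each of the three lines at
  most once. This contradicts the hypothesis on the corresponding independent triple of sets.
\<close>

section \<open>Rank and Rado's theorem\<close>

context matroid
begin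

lemma indep_finite: "indep X \<Longrightarrow> finite X"
  using indep_subset_carrier carrier_finite finite_subset by blast

lemma finite_indep_subsets: "finite {X. X \<subseteq> A \<and> indep X}"
proof (rule finite_subset)
  show "{X. X \<subseteq> A \<and> indep X} \<subseteq> Pow carrier"
    using indep_subset_carrier by blast
qed (simp add: carrier_finite)

lemma card_le_rank: "X \<subseteq> A \<Longrightarrow> indep X \<Longrightarrow> card X \<le> matroid_rank indep A"
  unfolding matroid_rank_def
  by (rule Max_ge) (use finite_indep_subsets[of A] in auto)

lemma rank_attained:
  obtains X where "X \<subseteq> A" "indep X" "card X = matroid_rank indep A"
proof -
  have "Max (card ` {X. X \<subseteq> A \<and> indep X}) \<in> card ` {X. X \<subseteq> A \<and> indep X}"
    using finite_indep_subsets[of A] indep_empty by (intro Max_in) auto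
  then obtain X where "X \<subseteq> A" "indep X" "card X = Max (card ` {X. X \<subseteq> A \<and> indep X})"
    by auto
  then show thesis
    using that[of X] by (simp add: matroid_rank_def)
qed

lemma rank_mono: "A \<subseteq> B \<Longrightarrow> matroid_rank indep A \<le> matroid_rank indep B"
  by (metis card_le_rank rank_attained order_trans)

lemma rank_le_card: "finite A \<Longrightarrow> matroid_rank indep A \<le> card A"
  by (metis card_mono rank_attained)

lemma rank_indep: "indep A \<Longrightarrow> matroid_rank indep A = card A"
  by (simp add: card_le_rank indep_finite rank_le_card le_antisym)

lemma indep_extend_within:
  assumes "indep X" "X \<subseteq> A"
  obtains Y where "X \<subseteq> Y" "Y \<subseteq> A" "indep Y" "card Y = matroid_rank indep A"
  using assms
proof (induction "matroid_rank indep A - card X" arbitrary: X thesis rule: less_induct)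
  case less
  show ?case
  proof (cases "card X < matroid_rank indep A")
    case True
    obtain Z where Z: "Z \<subseteq> A" "indep Z" "card Z = matroid_rank indep A"
      by (rule rank_attained)
    then obtain y where y: "y \<in> Z - X" "indep (insert y X)"
      using augment[OF less.prems(2) Z(2)] True by auto
    have "card (insert y X) = Suc (card X)"
      using y(1) indep_finite[OF less.prems(2)] by simp
    then show ?thesis
      using less.hyps[of "insert y X"] less.prems y Z(1) True
      by (metis DiffD1 diff_less_mono2 insert_subset lessI subsetD)
  next
    case False
    then show ?thesis
      using less.prems card_le_rank by (metis le_antisym linorder_not_less order_refl)
  qed
qed

text \<open>A largest independent subset \<open>X\<close> of \<open>A \<inter> B\<close> extends to
  a largest independent subset \<open>Y\<close> of \<open>A \<union> B\<close>; inclusion-exclusion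
  for \<open>Y \<inter> A\<close> and \<open>Y \<inter> B\<close> gives the inequality.\<close>

lemma rank_submodular:
  "matroid_rank indep (A \<union> B) + matroid_rank indep (A \<inter> B)
    \<le> matroid_rank indep A + matroid_rank indep B"
proof -
  obtain X where X: "X \<subseteq> A \<inter> B" "indep X" "card X = matroid_rank indep (A \<inter> B)"
    by (rule rank_attained)
  then obtain Y where Y: "X \<subseteq> Y" "Y \<subseteq> A \<union> B" "indep Y" "card Y = matroid_rank indep (A \<union> B)"
    using indep_extend_within[of X "A \<union> B"] by blast
  have "card (Y \<inter> A) + card (Y \<inter> B) = card ((Y \<inter> A) \<union> (Y \<inter> B)) + card ((Y \<inter> A) \<inter> (Y \<inter> B))"
    using indep_finite[OF Y(3)] by (intro card_Un_Int) auto
  moreover have "(Y \<inter> A) \<union> (Y \<inter> B) = Y"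
    using Y by blast
  moreover have "card X \<le> card ((Y \<inter> A) \<inter> (Y \<inter> B))"
    using X Y indep_finite[OF Y(3)] by (intro card_mono) auto
  moreover have "card (Y \<inter> A) \<le> matroid_rank indep A" "card (Y \<inter> B) \<le> matroid_rank indep B"
    using card_le_rank indep_subset[OF Y(3)] by auto
  ultimately show ?thesis
    using X(3) Y(4) by simp
qed

text \<open>Sets are shrunk one element at a time while the rank condition survives. By
  submodularity, one of any two elements of a set can be removed; once all sets are singletons, the
  condition for \<open>J\<close> itself makes them an independent transversal.\<close>

theorem rado:
  fixes A :: "'n \<Rightarrow> 'a set"
  assumes "finite J" "\<And>i. i \<in> J \<Longrightarrow> finite (A i)"
    and "\<And>S. S \<subseteq> J \<Longrightarrow> card S \<le> matroid_rank indep (\<Union>i\<in>S. A i)"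
  obtains c where "\<And>i. i \<in> J \<Longrightarrow> c i \<in> A i" "inj_on c J" "indep (c ` J)"
  using assms
proof (induction "\<Sum>i\<in>J. card (A i)" arbitrary: A thesis rule: less_induct)
  case less
  note fin = less.prems(2,3) and hall = less.prems(4)
  show ?case
  proof (cases "\<exists>k\<in>J. \<exists>y\<in>A k. \<exists>z\<in>A k. y \<noteq> z")
    case True
    then obtain k y z where k: "k \<in> J" "y \<in> A k" "z \<in> A k" "y \<noteq> z" by blast
    \<comment> \<open>After deletion of \<open>w\<close> from \<open>A k\<close>, the set
      \<open>insert k S\<close> violates the rank condition; as it has one element more than
      \<open>S\<close>, the violation reads \<open>\<le> card S\<close>.\<close>
    have remove: "\<exists>S\<subseteq>J - {k}. matroid_rank indep ((A k - {w}) \<union> (\<Union>i\<in>S. A i)) \<le> card S"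
      if w: "w \<in> A k"
        and no: "\<nexists>c. (\<forall>i\<in>J. c i \<in> A i) \<and> inj_on c J \<and> indep (c ` J)" for w
    proof (rule ccontr)
      assume neg: "\<not> ?thesis"
      define A' where "A' = A(k := A k - {w})"
      have "(\<Sum>i\<in>J. card (A' i)) < (\<Sum>i\<in>J. card (A i))"
      proof (rule sum_strict_mono_ex1)
        show "\<exists>i\<in>J. card (A' i) < card (A i)"
          using k(1) card_Diff1_less[OF fin(2)[OF k(1)] w]
          by (intro bexI[of _ k]) (simp_all add: A'_def del: card_Diff_insert)
      qed (use fin(1) in \<open>auto simp: A'_def card_Diff1_le\<close>)
      moreover have "card S \<le> matroid_rank indep (\<Union>i\<in>S. A' i)" if S: "S \<subseteq> J" for S
      proof (cases "k \<in> S")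
        case True
        have "(\<Union>i\<in>S. A' i) = (A k - {w}) \<union> (\<Union>i\<in>S - {k}. A i)"
          using True by (auto simp: A'_def split: if_splits)
        moreover have "card (S - {k}) < matroid_rank indep ((A k - {w}) \<union> (\<Union>i\<in>S - {k}. A i))"
          using neg S by (meson Diff_mono linorder_not_less order_refl)
        ultimately show ?thesis
          using True S fin(1) by (simp add: card_Diff_singleton)
      next
        case False
        then have "(\<Union>i\<in>S. A' i) = (\<Union>i\<in>S. A i)"
          by (auto simp: A'_def split: if_splits)
        then show ?thesis using hall S by simp
      qed
      moreover have "finite (A' i)" if "i \<in> J" for i
        using that fin by (auto simp: A'_def)
      ultimately obtain c where c: "\<And>i. i \<in> J \<Longrightarrow> c i \<in> A' i" "inj_on c J" "indep (c ` J)"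
        using less.hyps[of A'] fin(1) by blast
      have "c i \<in> A i" if "i \<in> J" for i
        using c(1)[OF that] by (auto simp: A'_def split: if_splits)
      with c no show False by blast
    qed
    have "\<exists>c. (\<forall>i\<in>J. c i \<in> A i) \<and> inj_on c J \<and> indep (c ` J)"
    proof (rule ccontr)
      assume no: "\<not> ?thesis"
      obtain S where S: "S \<subseteq> J - {k}"
        "matroid_rank indep ((A k - {y}) \<union> (\<Union>i\<in>S. A i)) \<le> card S"
        using remove[OF k(2) no] by blast
      obtain S' where S': "S' \<subseteq> J - {k}"
        "matroid_rank indep ((A k - {z}) \<union> (\<Union>i\<in>S'. A i)) \<le> card S'"
        using remove[OF k(3) no] by blast
      let ?X = "(A k - {y}) \<union> (\<Union>i\<in>S. A i)" and ?Y = "(A k - {z}) \<union> (\<Union>i\<in>S'. A i)"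
      have finS: "finite S" "finite S'"
        using S(1) S'(1) fin(1) by (meson finite_Diff finite_subset)+
      \<comment> \<open>As \<open>y \<noteq> z\<close>, the two reduced copies of \<open>A k\<close>
        together restore \<open>A k\<close>. The rank condition for
        \<open>insert k (S \<union> S')\<close> and \<open>S \<inter> S'\<close> then exceeds by one
        what submodularity allows.\<close>
      have "(\<Union>i\<in>insert k (S \<union> S'). A i) = ?X \<union> ?Y"
        using k(4) by auto
      moreover have "card (insert k (S \<union> S')) \<le> matroid_rank indep (\<Union>i\<in>insert k (S \<union> S'). A i)"
        by (rule hall) (use S(1) S'(1) k(1) in auto)
      ultimately have "card (insert k (S \<union> S')) \<le> matroid_rank indep (?X \<union> ?Y)"
        by (simp only:)
      moreover have "k \<notin> S \<union> S'"
        using S(1) S'(1) by auto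
      ultimately have "Suc (card (S \<union> S')) \<le> matroid_rank indep (?X \<union> ?Y)"
        using finS by simp
      moreover have "card (S \<inter> S') \<le> matroid_rank indep (\<Union>i\<in>S \<inter> S'. A i)"
        using hall S(1) by blast
      moreover have "\<dots> \<le> matroid_rank indep (?X \<inter> ?Y)"
        by (rule rank_mono) auto
      moreover have "card S + card S' = card (S \<union> S') + card (S \<inter> S')"
        using finS by (rule card_Un_Int)
      ultimately show False
        using rank_submodular[of ?X ?Y] S(2) S'(2) by linarith
    qed
    then show ?thesis using less.prems(1) by blast
  next
    case False
    have "A i \<noteq> {}" if "i \<in> J" for i
    proof
      assume "A i = {}"
      then show False
        using hall[of "{i}"] that rank_le_card[of "{}"] by simp
    qed
    then have "\<forall>i\<in>J. \<exists>a. A i = {a}"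
      using False by (metis is_singletonE is_singletonI')
    then obtain c where c: "\<And>i. i \<in> J \<Longrightarrow> A i = {c i}"
      by metis
    have "(\<Union>i\<in>J. A i) = c ` J"
      using c by auto
    then have le: "card J \<le> matroid_rank indep (c ` J)"
      using hall[of J] by simp
    have "matroid_rank indep (c ` J) \<le> card (c ` J)"
      using fin(1) by (simp add: rank_le_card)
    then have card: "card (c ` J) = card J"
      using le card_image_le[OF fin(1), of c] by linarith
    obtain X where X: "X \<subseteq> c ` J" "indep X" "card X = matroid_rank indep (c ` J)"
      by (rule rank_attained)
    then have "X = c ` J"
      using le card fin(1) by (metis card_seteq finite_imageI)
    then show ?thesis
      using less.prems(1)[of c] c X(2) card fin(1) by (simp add: eq_card_imp_inj_on)
  qed
qed

end

section \<open>A KKM theorem for matroids\<close>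

definition prob_simplex :: "(real ^ 'n) set" where
  "prob_simplex = {x. (\<forall>i. 0 \<le> x $ i) \<and> (\<Sum>i\<in>UNIV. x $ i) = 1}"

lemma prob_simplex_nonneg: "x \<in> prob_simplex \<Longrightarrow> 0 \<le> x $ i"
  by (simp add: prob_simplex_def)

lemma sum_prob_simplex: "x \<in> prob_simplex \<Longrightarrow> (\<Sum>i\<in>UNIV. x $ i) = 1"
  by (simp add: prob_simplex_def)

lemma compact_prob_simplex: "compact (prob_simplex :: (real ^ 'n) set)"
proof -
  have le: "x $ i \<le> 1" if "\<forall>i. 0 \<le> x $ i" "(\<Sum>i\<in>UNIV. x $ i) = 1" for x :: "real ^ 'n" and i
    using that member_le_sum[of i UNIV "\<lambda>i. x $ i"] by simp
  have "prob_simplex = cbox 0 (\<chi> i. 1) \<inter> {x :: real ^ 'n. (\<Sum>i\<in>UNIV. x $ i) = 1}"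
    by (auto simp: prob_simplex_def mem_box_cart intro: le)
  moreover have "closed {x :: real ^ 'n. (\<Sum>i\<in>UNIV. x $ i) = 1}"
    by (intro closed_Collect_eq continuous_intros)
  ultimately show ?thesis
    using compact_Int_closed[OF compact_cbox] by metis
qed

lemma convex_prob_simplex: "convex (prob_simplex :: (real ^ 'n) set)"
  by (auto simp: prob_simplex_def convex_def sum.distrib simp flip: sum_distrib_left)

lemma prob_simplex_nonempty: "(prob_simplex :: (real ^ 'n) set) \<noteq> {}"
proof -
  have "(\<chi> i. 1 / real CARD('n)) \<in> (prob_simplex :: (real ^ 'n) set)"
    by (simp add: prob_simplex_def)
  then show ?thesis by blast
qed

text \<open>The face condition makes this a surjectivity form of Brouwer's theorem; it serves below
  to give all indices equal mass.\<close>

lemma boundary_respecting_map_attains: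
  fixes g :: "real ^ 'n \<Rightarrow> 'n \<Rightarrow> real"
  assumes cont: "\<And>i. continuous_on prob_simplex (\<lambda>x. g x i)"
    and total: "\<And>x. x \<in> prob_simplex \<Longrightarrow> (\<Sum>i\<in>UNIV. g x i) = (\<Sum>i\<in>UNIV. b i)"
    and face: "\<And>x i. x \<in> prob_simplex \<Longrightarrow> x $ i = 0 \<Longrightarrow> g x i = 0"
    and pos: "\<And>i. 0 < b i"
  obtains x where "x \<in> prob_simplex" "\<And>i. g x i = b i"
proof -
  \<comment> \<open>At a fixed point of \<open>T\<close> the deficit \<open>e x\<close> is proportional to \<open>x\<close>, which forces it to vanish.\<close>
  define e where "e x i = max 0 (b i - g x i)" for x i
  define E where "E x = (\<Sum>i\<in>UNIV. e x i)" for x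
  have e0: "0 \<le> e x i" for x i
    by (simp add: e_def)
  then have E0: "0 \<le> E x" for x
    by (simp add: E_def sum_nonneg)
  define T where "T x = (\<chi> i. (x $ i + e x i) / (1 + E x))" for x
  have contE: "continuous_on prob_simplex (\<lambda>x. e x i)" for i
    unfolding e_def by (intro continuous_intros cont)
  have "continuous_on prob_simplex T"
    unfolding T_def continuous_on_vec_lambda
    unfolding E_def
    by (intro continuous_intros contE continuous_on_vec_lambda)
      (metis E0 E_def add_pos_nonneg less_irrefl zero_less_one)
  moreover have "T \<in> prob_simplex \<rightarrow> prob_simplex"
  proof
    fix x :: "real ^ 'n" assume x: "x \<in> prob_simplex"
    have "(\<Sum>i\<in>UNIV. T x $ i) = (\<Sum>i\<in>UNIV. x $ i + e x i) / (1 + E x)"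
      by (simp add: T_def sum_divide_distrib)
    also have "\<dots> = 1"
      using E0[of x] sum_prob_simplex[OF x] by (simp add: sum.distrib E_def)
    finally show "T x \<in> prob_simplex"
      using e0 E0 prob_simplex_nonneg[OF x] by (simp add: prob_simplex_def T_def)
  qed
  ultimately obtain x where x: "x \<in> prob_simplex" "T x = x"
    using brouwer[OF compact_prob_simplex convex_prob_simplex prob_simplex_nonempty] by blast
  have fixpt: "e x i = x $ i * E x" for i
  proof -
    have "(x $ i + e x i) / (1 + E x) = x $ i"
      using x(2) by (metis T_def vec_lambda_beta)
    then show ?thesis
      using E0[of x] by (simp add: field_simps)
  qed
  have "E x = 0"
  proof (rule ccontr)
    assume "E x \<noteq> 0"
    have "g x i < b i" for i
    proof (cases "x $ i = 0")
      case True
      then show ?thesis using face[OF x(1)] pos by simp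
    next
      case False
      then have "e x i \<noteq> 0"
        using fixpt \<open>E x \<noteq> 0\<close> by simp
      then show ?thesis by (simp add: e_def max_def split: if_splits)
    qed
    then have "(\<Sum>i\<in>UNIV. g x i) < (\<Sum>i\<in>UNIV. b i)"
      by (intro sum_strict_mono) auto
    then show False using total[OF x(1)] by simp
  qed
  then have ge: "b i \<le> g x i" for i
    using fixpt[of i] by (simp add: e_def)
  have "g x i = b i" for i
  proof (rule ccontr)
    assume "g x i \<noteq> b i"
    then have "(\<Sum>i\<in>UNIV. b i) < (\<Sum>i\<in>UNIV. g x i)"
      using ge by (intro sum_strict_mono_ex1) (auto intro!: exI[of _ i] simp: less_le)
    then show False using total[OF x(1)] by simp
  qed
  then show thesis using that x(1) by blast
qed

text \<open>Distributing the weights of the bases among the indices gives a map that respects the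
  faces of the simplex. Where all indices receive equal mass, counting mass yields Rado's
  condition.\<close>

theorem (in matroid) matroid_KKM:
  fixes d :: "'a \<Rightarrow> 'n::finite \<Rightarrow> real ^ 'n \<Rightarrow> real"
  assumes cont: "\<And>C i. continuous_on prob_simplex (d C i)"
    and nonneg: "\<And>C i x. 0 \<le> d C i x"
    and face: "\<And>C i x. x \<in> prob_simplex \<Longrightarrow> x $ i = 0 \<Longrightarrow> d C i x = 0"
    and cover: "\<And>x. x \<in> prob_simplex \<Longrightarrow>
      \<exists>B. indep B \<and> card B = CARD('n) \<and> (\<forall>C\<in>B. \<exists>i. 0 < d C i x)"
  obtains x c where "x \<in> prob_simplex" "inj c" "indep (range c)" "\<forall>i. 0 < d (c i) i x"
proof -
  \<comment> \<open>\<open>G x i\<close> is the mass received by \<open>i\<close> when each basis \<open>B\<close> has weight \<open>W B x\<close>, every element of it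
    carries that weight, and splits it in proportion to \<open>d C i x\<close>. Writing \<open>W (B - {C})\<close> instead of
    \<open>W B / D C\<close> keeps \<open>G\<close> continuous where \<open>D C\<close> vanishes.\<close>
  define \<B> where "\<B> = {B. indep B \<and> card B = CARD('n)}"
  define D where "D C x = (\<Sum>i\<in>UNIV. d C i x)" for C x
  define W where "W B x = (\<Prod>C\<in>B. D C x)" for B x
  define \<Phi> where "\<Phi> x = (\<Sum>B\<in>\<B>. W B x)" for x
  define G where "G x i = (\<Sum>B\<in>\<B>. \<Sum>C\<in>B. d C i x * W (B - {C}) x)" for x i
  have fin\<B>: "finite \<B>"
    by (rule finite_subset[of _ "Pow carrier"])
      (use indep_subset_carrier carrier_finite in \<open>auto simp: \<B>_def\<close>)
  have finB: "finite B" if "B \<in> \<B>" for B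
    using that indep_finite by (simp add: \<B>_def)
  have D0: "0 \<le> D C x" for C x
    by (simp add: D_def sum_nonneg nonneg)
  have W0: "0 \<le> W B x" for B x
    by (simp add: W_def prod_nonneg D0)
  have Wsplit: "D C x * W (B - {C}) x = W B x" if "B \<in> \<B>" "C \<in> B" for B C x
    unfolding W_def using finB[OF that(1)] that(2) by (simp add: prod.remove)
  have \<Phi>pos: "0 < \<Phi> x" if x: "x \<in> prob_simplex" for x
  proof -
    obtain B where B: "indep B" "card B = CARD('n)" "\<forall>C\<in>B. \<exists>i. 0 < d C i x"
      using cover[OF x] by blast
    have "0 < D C x" if C: "C \<in> B" for C
    proof -
      obtain i where "0 < d C i x"
        using B(3) C by blast
      then show ?thesis
        unfolding D_def by (intro sum_pos2[of _ i]) (auto simp: nonneg)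
    qed
    then have "0 < W B x"
      by (simp add: W_def prod_pos)
    then show ?thesis
      unfolding \<Phi>_def using B fin\<B> by (intro sum_pos2[of _ B]) (auto simp: \<B>_def W0)
  qed
  have contW: "continuous_on prob_simplex (W B)" for B
    unfolding W_def D_def by (intro continuous_intros cont)
  have "continuous_on prob_simplex (\<lambda>x. G x i / \<Phi> x)" for i
    unfolding G_def \<Phi>_def
    by (intro continuous_intros cont contW) (use \<Phi>pos in \<open>auto simp: \<Phi>_def less_le\<close>)
  moreover have "(\<Sum>i\<in>UNIV. G x i / \<Phi> x) = (\<Sum>i\<in>(UNIV :: 'n set). 1)" if x: "x \<in> prob_simplex" for x
  proof -
    \<comment> \<open>Each basis hands out its weight once per element, so the total is
      \<open>CARD('n)\<close> times \<open>\<Phi> x\<close>.\<close>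
    have "(\<Sum>i\<in>UNIV. G x i) = (\<Sum>B\<in>\<B>. \<Sum>C\<in>B. \<Sum>i\<in>UNIV. d C i x * W (B - {C}) x)"
      unfolding G_def by (subst sum.swap, subst sum.swap) simp
    also have "\<dots> = (\<Sum>B\<in>\<B>. \<Sum>C\<in>B. W B x)"
      using Wsplit by (intro sum.cong refl) (simp add: D_def flip: sum_distrib_right)
    also have "\<dots> = real CARD('n) * \<Phi> x"
      by (simp add: \<Phi>_def \<B>_def sum_distrib_left)
    finally show ?thesis
      using \<Phi>pos[OF x] by (simp flip: sum_divide_distrib)
  qed
  moreover have "G x i / \<Phi> x = 0" if "x \<in> prob_simplex" "x $ i = 0" for x i
    using face[OF that] by (simp add: G_def)
  ultimately obtain x where x: "x \<in> prob_simplex" "\<And>i. G x i / \<Phi> x = 1"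
    by (rule boundary_respecting_map_attains[where b = "\<lambda>_. 1"]) simp_all
  have G\<Phi>: "G x i = \<Phi> x" for i
    using x(2)[of i] \<Phi>pos[OF x(1)] by simp
  define A where "A i = {C \<in> carrier. 0 < d C i x}" for i
  \<comment> \<open>The indices in \<open>S\<close> receive mass \<open>card S * \<Phi> x\<close>.
    It comes only from elements of the union of the \<open>A i\<close>; a basis contains at most as
    many of those as the rank of the union, and each passes on at most \<open>W B x\<close>.\<close>
  have "card S \<le> matroid_rank indep (\<Union>i\<in>S. A i)" for S :: "'n set"
  proof -
    have "real (card S) * \<Phi> x = (\<Sum>i\<in>S. G x i)"
      by (simp add: G\<Phi>)
    also have "\<dots> = (\<Sum>B\<in>\<B>. \<Sum>C\<in>B. \<Sum>i\<in>S. d C i x * W (B - {C}) x)"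
      unfolding G_def by (subst sum.swap, subst sum.swap) simp
    also have "\<dots> \<le> (\<Sum>B\<in>\<B>. real (matroid_rank indep (\<Union>i\<in>S. A i)) * W B x)"
    proof (rule sum_mono)
      fix B assume B: "B \<in> \<B>"
      let ?U = "\<Union>i\<in>S. A i"
      have "(\<Sum>C\<in>B. \<Sum>i\<in>S. d C i x * W (B - {C}) x) = (\<Sum>C\<in>B \<inter> ?U. \<Sum>i\<in>S. d C i x * W (B - {C}) x)"
      proof (rule sum.mono_neutral_right)
        show "\<forall>C\<in>B - B \<inter> ?U. (\<Sum>i\<in>S. d C i x * W (B - {C}) x) = 0"
        proof
          fix C assume C: "C \<in> B - B \<inter> ?U"
          then have "C \<in> carrier"
            using B indep_subset_carrier by (auto simp: \<B>_def)
          then have "d C i x = 0" if "i \<in> S" for i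
            using C that nonneg[of C i x] by (force simp: A_def less_le)
          then show "(\<Sum>i\<in>S. d C i x * W (B - {C}) x) = 0" by simp
        qed
      qed (use finB[OF B] in auto)
      also have "\<dots> \<le> (\<Sum>C\<in>B \<inter> ?U. W B x)"
      proof (rule sum_mono)
        fix C assume C: "C \<in> B \<inter> ?U"
        have "(\<Sum>i\<in>S. d C i x) \<le> D C x"
          unfolding D_def by (intro sum_mono2) (auto simp: nonneg)
        then show "(\<Sum>i\<in>S. d C i x * W (B - {C}) x) \<le> W B x"
          using Wsplit[OF B, of C x] C W0 by (metis IntD1 mult_right_mono sum_distrib_right)
      qed
      also have "\<dots> = real (card (B \<inter> ?U)) * W B x"
        by simp
      also have "\<dots> \<le> real (matroid_rank indep ?U) * W B x"
        using card_le_rank[of "B \<inter> ?U" ?U] indep_subset[of B "B \<inter> ?U"] B W0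
        by (intro mult_right_mono) (auto simp: \<B>_def)
      finally show "(\<Sum>C\<in>B. \<Sum>i\<in>S. d C i x * W (B - {C}) x) \<le> real (matroid_rank indep ?U) * W B x" .
    qed
    also have "\<dots> = real (matroid_rank indep (\<Union>i\<in>S. A i)) * \<Phi> x"
      by (simp add: \<Phi>_def sum_distrib_left)
    finally show ?thesis
      using \<Phi>pos[OF x(1)] by simp
  qed
  moreover have "finite (A i)" for i
    using carrier_finite by (simp add: A_def)
  ultimately obtain c where "\<And>i. c i \<in> A i" "inj c" "indep (range c)"
    using rado[of "UNIV :: 'n set" A] by auto
  then show thesis
    using that[OF x(1)] by (simp add: A_def)
qed

section \<open>Three chords of a circle\<close>

text \<open>
  The affine function that vanishes on the chord between the points at angles \<open>\<alpha>\<close> and \<open>\<beta>\<close> of the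
  circle of radius \<open>R\<close> about \<open>0\<close>, positive on the open arc from \<open>\<alpha>\<close> to \<open>\<beta>\<close>. In this form it
  degenerates to the tangent when the endpoints coincide.
\<close>
definition chord :: "real \<Rightarrow> real \<Rightarrow> real \<Rightarrow> real ^ 2 \<Rightarrow> real" where
  "chord R \<alpha> \<beta> p =
     p $ 1 * cos ((\<alpha> + \<beta>) / 2) + p $ 2 * sin ((\<alpha> + \<beta>) / 2) - R * cos ((\<beta> - \<alpha>) / 2)"

text \<open>The complementary arc has the same chord, but its midpoint angle is shifted by pi, which
  reverses the normal.\<close>

lemma chord_swap: "chord R \<beta> (\<alpha> + 2 * pi) p = - chord R \<alpha> \<beta> p"
proof -
  have mid: "(\<beta> + (\<alpha> + 2 * pi)) / 2 = (\<alpha> + \<beta>) / 2 + pi"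
    and half: "(\<alpha> + 2 * pi - \<beta>) / 2 = pi - (\<beta> - \<alpha>) / 2"
    by (simp_all add: field_simps)
  show ?thesis
    unfolding chord_def mid half by (simp only: cos_add sin_add cos_diff) simp
qed

lemma chord_affine_combination:
  "chord R \<alpha> \<beta> ((1 - t) *\<^sub>R p + t *\<^sub>R q) = (1 - t) * chord R \<alpha> \<beta> p + t * chord R \<alpha> \<beta> q"
  by (simp add: chord_def algebra_simps)

lemma is_line_chord: "is_line {p. chord R \<alpha> \<beta> p = 0}"
proof -
  let ?m = "(\<alpha> + \<beta>) / 2"
  define u :: "real ^ 2" where "u = vector [cos ?m, sin ?m]"
  have "u \<noteq> 0"
  proof
    assume "u = 0"
    then have "u $ 1 = 0" "u $ 2 = 0" by simp_all
    then show False
      using sin_cos_squared_add[of ?m] by (simp add: u_def)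
  qed
  moreover have "{p. chord R \<alpha> \<beta> p = 0} = {p. u \<bullet> p = R * cos ((\<beta> - \<alpha>) / 2)}"
    by (simp add: chord_def u_def inner_vec_def sum_2 mult.commute)
  ultimately show ?thesis
    unfolding is_line_def by (simp add: affine_hyperplane aff_dim_hyperplane)
qed

lemma chord_constant_sign:
  assumes "convex C" "C \<inter> {p. chord R \<alpha> \<beta> p = 0} = {}"
  shows "(\<forall>p\<in>C. 0 < chord R \<alpha> \<beta> p) \<or> (\<forall>p\<in>C. chord R \<alpha> \<beta> p < 0)"
proof (rule ccontr)
  let ?f = "chord R \<alpha> \<beta>"
  assume "\<not> ?thesis"
  then obtain p q where pq: "p \<in> C" "q \<in> C" "?f p \<le> 0" "0 \<le> ?f q"
    by (meson linorder_not_less)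
  then have lt: "?f p < 0" "0 < ?f q"
    using assms(2) by (force simp: less_le)+
  define t where "t = - ?f p / (?f q - ?f p)"
  have t: "0 \<le> t" "t \<le> 1"
    using lt by (simp_all add: t_def divide_simps)
  have "?f ((1 - t) *\<^sub>R p + t *\<^sub>R q) = 0"
    unfolding chord_affine_combination using lt by (simp add: t_def field_simps)
  moreover have "(1 - t) *\<^sub>R p + t *\<^sub>R q \<in> C"
    using convexD[OF assms(1) pq(1,2)] t by simp
  ultimately show False
    using assms(2) by blast
qed

text \<open>Inside the disc, the caps cut off by chords from the fixed endpoint \<alpha> grow as the
  other endpoint advances.\<close>

lemma chords_common_endpoint:
  assumes p: "norm p < R" and "\<alpha> \<le> \<beta>" "\<beta> \<le> \<gamma>" "\<gamma> \<le> \<alpha> + 2 * pi"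
    and pos: "0 < chord R \<alpha> \<beta> p"
  shows "0 \<le> chord R \<alpha> \<gamma> p"
proof (rule ccontr)
  assume neg: "\<not> ?thesis"
  define s t where "s = (\<beta> - \<alpha>) / 2" and "t = (\<gamma> - \<alpha>) / 2"
  have st: "0 \<le> s" "s \<le> t" "t \<le> pi"
    using assms by (simp_all add: s_def t_def)
  \<comment> \<open>Radial and tangential coordinates of \<open>p\<close> with respect to the
    endpoint at angle \<alpha>; \<open>a < R\<close> because \<open>p\<close> is inside the
    disc.\<close>
  define a b where "a = p $ 1 * cos \<alpha> + p $ 2 * sin \<alpha>" and "b = p $ 2 * cos \<alpha> - p $ 1 * sin \<alpha>"
  have "a = p \<bullet> vector [cos \<alpha>, sin \<alpha>]"
    by (simp add: a_def inner_vec_def sum_2)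
  also have "\<dots> \<le> norm p * norm (vector [cos \<alpha>, sin \<alpha>] :: real ^ 2)"
    by (rule norm_cauchy_schwarz)
  also have "norm (vector [cos \<alpha>, sin \<alpha>] :: real ^ 2) = 1"
    by (simp add: norm_vec_def L2_set_def sum_2)
  finally have a: "a < R"
    using p by simp
  have \<alpha>\<beta>: "(\<alpha> + \<beta>) / 2 = \<alpha> + s" "(\<alpha> + \<gamma>) / 2 = \<alpha> + t"
    by (simp_all add: s_def t_def field_simps)
  have fs: "chord R \<alpha> \<beta> p = b * sin s - (R - a) * cos s"
    unfolding chord_def \<alpha>\<beta> s_def[symmetric] a_def b_def
    by (simp add: cos_add sin_add algebra_simps)
  have ft: "chord R \<alpha> \<gamma> p = b * sin t - (R - a) * cos t"
    unfolding chord_def \<alpha>\<beta> t_def[symmetric] a_def b_def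
    by (simp add: cos_add sin_add algebra_simps)
  \<comment> \<open>This combination eliminates \<open>b\<close>. Its left side is a sum of
    nonnegative terms by \<open>pos\<close> and \<open>neg\<close>, its right side is nonpositive,
    so all terms vanish. Only \<open>s = pi\<close> remains, where both chord functions
    agree.\<close>
  have "sin t * chord R \<alpha> \<beta> p - sin s * chord R \<alpha> \<gamma> p = - (R - a) * sin (t - s)"
    unfolding fs ft by (simp add: sin_diff algebra_simps)
  moreover have "0 \<le> (R - a) * sin (t - s)"
    using a st by (intro mult_nonneg_nonneg sin_ge_zero) auto
  moreover have "0 \<le> sin t * chord R \<alpha> \<beta> p" "0 \<le> - (sin s * chord R \<alpha> \<gamma> p)"
    using pos neg st sin_ge_zero[of s] sin_ge_zero[of t] by (auto intro: mult_nonneg_nonpos)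
  ultimately have "sin s * chord R \<alpha> \<gamma> p = 0"
    by linarith
  then have "sin s = 0"
    using neg by auto
  moreover have "s \<noteq> 0"
    using pos fs a by auto
  ultimately have "s = pi"
    using st sin_gt_zero[of s] by force
  then have "chord R \<alpha> \<gamma> p = chord R \<alpha> \<beta> p"
    using st fs ft by simp
  then show False
    using pos neg by simp
qed

text \<open>A positive combination of the three normals vanishes, so the same combination of the
  affine functions is constant and cannot be positive at \<open>p\<close> and negative at
  \<open>q\<close>.\<close>

lemma positively_spanning_normals:
  fixes f :: "real \<Rightarrow> real \<Rightarrow> real ^ 2 \<Rightarrow> real"
  defines "f m k p \<equiv> p $ 1 * cos m + p $ 2 * sin m - k"
  assumes "0 < m\<^sub>2 - m\<^sub>1" "m\<^sub>2 - m\<^sub>1 < pi" "0 < m\<^sub>3 - m\<^sub>2" "m\<^sub>3 - m\<^sub>2 < pi"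
    and "0 < m\<^sub>1 + 2 * pi - m\<^sub>3" "m\<^sub>1 + 2 * pi - m\<^sub>3 < pi"
    and p: "0 < f m\<^sub>1 k\<^sub>1 p" "0 < f m\<^sub>2 k\<^sub>2 p" "0 < f m\<^sub>3 k\<^sub>3 p"
    and q: "f m\<^sub>1 k\<^sub>1 q < 0" "f m\<^sub>2 k\<^sub>2 q < 0" "f m\<^sub>3 k\<^sub>3 q < 0"
  shows False
proof -
  \<comment> \<open>The weights are the determinants in the linear relation between three plane
    vectors; gaps strictly between 0 and pi make them positive.\<close>
  define c\<^sub>1 c\<^sub>2 c\<^sub>3 where "c\<^sub>1 = sin (m\<^sub>3 - m\<^sub>2)" and "c\<^sub>2 = sin (m\<^sub>1 - m\<^sub>3)" and "c\<^sub>3 = sin (m\<^sub>2 - m\<^sub>1)"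
  have "sin (m\<^sub>1 - m\<^sub>3) = sin (m\<^sub>1 + 2 * pi - m\<^sub>3)"
    by (metis add_diff_eq diff_add_eq sin_periodic)
  then have c: "0 < c\<^sub>1" "0 < c\<^sub>2" "0 < c\<^sub>3"
    using assms by (auto simp: c\<^sub>1_def c\<^sub>2_def c\<^sub>3_def intro: sin_gt_zero)
  have cos0: "c\<^sub>1 * cos m\<^sub>1 + c\<^sub>2 * cos m\<^sub>2 + c\<^sub>3 * cos m\<^sub>3 = 0"
    and sin0: "c\<^sub>1 * sin m\<^sub>1 + c\<^sub>2 * sin m\<^sub>2 + c\<^sub>3 * sin m\<^sub>3 = 0"
    by (simp_all add: c\<^sub>1_def c\<^sub>2_def c\<^sub>3_def sin_diff algebra_simps)
  have const: "c\<^sub>1 * f m\<^sub>1 k\<^sub>1 v + c\<^sub>2 * f m\<^sub>2 k\<^sub>2 v + c\<^sub>3 * f m\<^sub>3 k\<^sub>3 v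
      = - (c\<^sub>1 * k\<^sub>1 + c\<^sub>2 * k\<^sub>2 + c\<^sub>3 * k\<^sub>3)" for v
  proof -
    have "c\<^sub>1 * f m\<^sub>1 k\<^sub>1 v + c\<^sub>2 * f m\<^sub>2 k\<^sub>2 v + c\<^sub>3 * f m\<^sub>3 k\<^sub>3 v
      = v $ 1 * (c\<^sub>1 * cos m\<^sub>1 + c\<^sub>2 * cos m\<^sub>2 + c\<^sub>3 * cos m\<^sub>3)
        + v $ 2 * (c\<^sub>1 * sin m\<^sub>1 + c\<^sub>2 * sin m\<^sub>2 + c\<^sub>3 * sin m\<^sub>3)
        - (c\<^sub>1 * k\<^sub>1 + c\<^sub>2 * k\<^sub>2 + c\<^sub>3 * k\<^sub>3)"
      by (simp add: f_def algebra_simps)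
    then show ?thesis by (simp add: cos0 sin0)
  qed
  have "0 < c\<^sub>1 * f m\<^sub>1 k\<^sub>1 p + c\<^sub>2 * f m\<^sub>2 k\<^sub>2 p + c\<^sub>3 * f m\<^sub>3 k\<^sub>3 p"
    using c p by (simp add: add_pos_pos)
  moreover have "c\<^sub>1 * f m\<^sub>1 k\<^sub>1 q + c\<^sub>2 * f m\<^sub>2 k\<^sub>2 q + c\<^sub>3 * f m\<^sub>3 k\<^sub>3 q < 0"
    using c q by (simp add: add_neg_neg mult_pos_neg)
  ultimately show False
    unfolding const by simp
qed

text \<open>Of three collinear points one lies between the other two. It satisfies two of the
  inequalities itself and inherits the third, which both outer points satisfy, by convexity.\<close>

lemma three_wedges_not_collinear:
  assumes none: "\<nexists>p. 0 < chord R \<alpha>\<^sub>1 \<beta>\<^sub>1 p \<and> 0 < chord R \<alpha>\<^sub>2 \<beta>\<^sub>2 p \<and> 0 < chord R \<alpha>\<^sub>3 \<beta>\<^sub>3 p"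
    and a: "0 < chord R \<alpha>\<^sub>1 \<beta>\<^sub>1 a" "0 < chord R \<alpha>\<^sub>2 \<beta>\<^sub>2 a"
    and b: "0 < chord R \<alpha>\<^sub>2 \<beta>\<^sub>2 b" "0 < chord R \<alpha>\<^sub>3 \<beta>\<^sub>3 b"
    and c: "0 < chord R \<alpha>\<^sub>3 \<beta>\<^sub>3 c" "0 < chord R \<alpha>\<^sub>1 \<beta>\<^sub>1 c"
  shows "\<not> collinear {a, b, c}"
proof
  have pos: "0 < chord R \<alpha> \<beta> z"
    if "between (x, y) z" "0 < chord R \<alpha> \<beta> x" "0 < chord R \<alpha> \<beta> y" for x y z \<alpha> \<beta>
  proof -
    have "z \<in> closed_segment x y"
      using that(1) by (simp add: between_mem_segment)
    then obtain t where t: "0 \<le> t" "t \<le> 1" "z = (1 - t) *\<^sub>R x + t *\<^sub>R y"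
      by (auto simp: closed_segment_def)
    show ?thesis
    proof (cases "t = 0")
      case False
      then have "0 < (1 - t) * chord R \<alpha> \<beta> x + t * chord R \<alpha> \<beta> y"
        using t that(2,3) by (intro add_nonneg_pos) simp_all
      then show ?thesis
        by (simp add: t(3) chord_affine_combination)
    qed (use t that(2) in simp)
  qed
  assume "collinear {a, b, c}"
  then consider "between (b, c) a" | "between (c, a) b" | "between (a, b) c"
    by (auto simp: collinear_between_cases)
  then show False
  proof cases
    case 1
    then show False using none a pos[OF 1 b(2) c(1)] by blast
  next
    case 2
    then show False using none b pos[OF 2 c(2) a(1)] by blast
  next
    case 3
    then show False using none c pos[OF 3 a(2) b(1)] by blast
  qed
qed

text \<open>Chords may coincide, whereas the theorem asks for exactly three lines. Missing ones are
  taken among the vertical lines \<open>l r\<close>, since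
  \<open>chord r 0 0 p = p $ 1 - r\<close>.\<close>

lemma three_lines_superset:
  fixes A :: "(real ^ 2) set set"
  assumes "finite A" "card A \<le> 3" "\<forall>L\<in>A. is_line L"
  obtains Ls where "A \<subseteq> Ls" "card Ls = 3" "\<forall>L\<in>Ls. is_line L"
proof -
  define l where "l r = {p :: real ^ 2. chord r 0 0 p = 0}" for r
  have "inj l"
  proof (rule injI)
    fix r s assume "l r = l s"
    moreover have "vector [r, 0] \<in> l r"
      by (simp add: l_def chord_def)
    ultimately have "vector [r, 0] \<in> l s" by simp
    then show "r = s"
      by (simp add: l_def chord_def)
  qed
  then have "infinite (range l)"
    using infinite_UNIV_char_0[where 'a = real] by (simp add: finite_image_iff)
  then have "infinite (range l - A)"
    using assms(1) by simp
  then obtain B where B: "B \<subseteq> range l - A" "finite B" "card B = 3 - card A"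
    using infinite_arbitrarily_large[of "range l - A" "3 - card A"] by auto
  have "card (A \<union> B) = card A + card B"
    using B assms(1) by (intro card_Un_disjoint) auto
  moreover have "\<forall>L\<in>A \<union> B. is_line L"
    using B(1) assms(3) is_line_chord by (auto simp: l_def)
  ultimately show thesis
    using that[of "A \<union> B"] B(3) assms(2) by simp
qed

text \<open>Six points in cyclic order on a circle, possibly coinciding. Indices continue
  periodically by full turns, so the endpoint opposite to point \<open>k\<close> is always point
  \<open>k + 3\<close>.\<close>

locale cyclic_angles =
  fixes \<theta> :: "nat \<Rightarrow> real" and R :: real
  assumes mono: "mono \<theta>"
    and periodic: "\<And>k. \<theta> (k + 6) = \<theta> k + 2 * pi"
begin

definition side :: "nat \<Rightarrow> real ^ 2 \<Rightarrow> real" where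
  "side k = chord R (\<theta> k) (\<theta> (k + 3))"

lemma side_shift: "side (k + 3) p = - side k p"
  using periodic[of k] chord_swap[of R "\<theta> (k + 3)" "\<theta> k" p] by (simp add: side_def add.commute)

lemma side_shift6: "side (k + 6) p = side k p"
  using side_shift[of "k + 3" p] side_shift[of k p] by (simp add: add.commute)

lemma side_numeral: "side 3 p = - side 0 p" "side 4 p = - side 1 p" "side 5 p = - side 2 p" "side 6 p = side 0 p"
    "side 7 p = side 1 p" "side 8 p = side 2 p" "side 9 p = - side 0 p"
  using side_shift[of 0 p] side_shift[of 1 p] side_shift[of 2 p] side_shift6[of 0 p] side_shift6[of 1 p]
    side_shift6[of 2 p] side_shift6[of 3 p]
  by simp_all

text \<open>If arc \<open>k\<close> has length 0, the two chords bounding its wedge share the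
  endpoint \<open>\<theta> k\<close>. The cap of the first lies in the cap of the second, whereas
  the wedge lies outside the latter.\<close>

lemma wedge_empty:
  assumes "norm p < R" "\<theta> (Suc k) = \<theta> k" "0 < side k p"
  shows "side (k + 4) p \<le> 0"
proof -
  have "\<theta> (k + 3) \<le> \<theta> (k + 4)" "\<theta> k \<le> \<theta> (k + 3)" "\<theta> (k + 4) \<le> \<theta> (k + 6)"
    using mono by (auto intro: monoD)
  then have "0 \<le> chord R (\<theta> k) (\<theta> (k + 4)) p"
    using assms periodic[of k] unfolding side_def
    by (intro chords_common_endpoint[of p R "\<theta> k" "\<theta> (k + 3)"]) auto
  then have "0 \<le> side (Suc k) p"
    using assms(2) by (simp add: side_def add.commute)
  then show ?thesis
    using side_shift[of "Suc k" p] by (simp add: add.commute)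
qed

text \<open>The wedge of index \<open>k\<close> is the region where \<open>side k\<close> and \<open>side (k + 4) = - side (k + 1)\<close> are positive.\<close>

lemma sign_pattern_in_wedge:
  assumes "\<forall>k<3. (\<forall>p\<in>P. 0 < side k p) \<or> (\<forall>p\<in>P. side k p < 0)"
  obtains k where "k < 6" "\<forall>p\<in>P. 0 < side k p \<and> 0 < side (k + 4) p"
proof -
  have "(\<forall>p\<in>P. 0 < side 0 p) \<or> (\<forall>p\<in>P. side 0 p < 0)"
    "(\<forall>p\<in>P. 0 < side 1 p) \<or> (\<forall>p\<in>P. side 1 p < 0)"
    "(\<forall>p\<in>P. 0 < side 2 p) \<or> (\<forall>p\<in>P. side 2 p < 0)"
    using assms by auto
  \<comment> \<open>Sides \<open>k\<close> and \<open>k + 3\<close> have opposite signs, so in the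
    cyclic sequence of six signs some plus is followed by a minus; that position is the index of the
    wedge.\<close>
  then have "(\<forall>p\<in>P. 0 < side 0 p \<and> 0 < side (0 + 4) p) \<or> (\<forall>p\<in>P. 0 < side 1 p \<and> 0 < side (1 + 4) p)
    \<or> (\<forall>p\<in>P. 0 < side 2 p \<and> 0 < side (2 + 4) p) \<or> (\<forall>p\<in>P. 0 < side 3 p \<and> 0 < side (3 + 4) p)
    \<or> (\<forall>p\<in>P. 0 < side 4 p \<and> 0 < side (4 + 4) p) \<or> (\<forall>p\<in>P. 0 < side 5 p \<and> 0 < side (5 + 4) p)"
    by (elim disjE) (simp_all add: side_numeral)
  then show thesis
    by (elim disjE) (erule that[rotated], simp)+
qed

text \<open>Sides 1, 3, 5 are the negatives of sides 4, 0, 2, so points realizing both alternating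
  patterns would contradict \<open>positively_spanning_normals\<close>.\<close>

lemma central_triangle_one_sided:
  assumes strict: "\<And>k. \<theta> k < \<theta> (Suc k)"
  obtains s where "s < 2" "\<nexists>p. 0 < side s p \<and> 0 < side (s + 2) p \<and> 0 < side (s + 4) p"
proof -
  have False if p: "0 < side 0 p" "0 < side 2 p" "0 < side 4 p"
    and q: "0 < side 1 q" "0 < side 3 q" "0 < side 5 q" for p q
  proof -
    have less: "\<theta> 0 < \<theta> 1" "\<theta> 1 < \<theta> 2" "\<theta> 2 < \<theta> 3" "\<theta> 3 < \<theta> 4" "\<theta> 4 < \<theta> 5" "\<theta> 5 < \<theta> 6"
      using strict[of 0] strict[of 1] strict[of 2] strict[of 3] strict[of 4] strict[of 5]
      by (simp_all add: eval_nat_numeral)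
    have wrap: "\<theta> 6 = \<theta> 0 + 2 * pi" "\<theta> 7 = \<theta> 1 + 2 * pi"
      using periodic[of 0] periodic[of 1] by simp_all
    have q': "side 0 q < 0" "side 2 q < 0" "side 4 q < 0"
      using q by (simp_all add: side_numeral)
    \<comment> \<open>Midpoint angles of the arcs of sides 0, 2, 4, that is, the directions of their
      normals. Strict growth of the angles keeps the gaps strictly between 0 and pi.\<close>
    define m\<^sub>1 m\<^sub>2 m\<^sub>3 where "m\<^sub>1 = (\<theta> 0 + \<theta> 3) / 2" and "m\<^sub>2 = (\<theta> 2 + \<theta> 5) / 2" and "m\<^sub>3 = (\<theta> 4 + \<theta> 7) / 2"
    note m = m\<^sub>1_def m\<^sub>2_def m\<^sub>3_def
    have "2 * m\<^sub>1 = \<theta> 0 + \<theta> 3" "2 * m\<^sub>2 = \<theta> 2 + \<theta> 5" "2 * m\<^sub>3 = \<theta> 4 + \<theta> 7"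
      by (simp_all add: m)
    then have gaps: "0 < m\<^sub>2 - m\<^sub>1" "m\<^sub>2 - m\<^sub>1 < pi" "0 < m\<^sub>3 - m\<^sub>2" "m\<^sub>3 - m\<^sub>2 < pi"
      "0 < m\<^sub>1 + 2 * pi - m\<^sub>3" "m\<^sub>1 + 2 * pi - m\<^sub>3 < pi"
      using less wrap by linarith+
    show False
      using p q'
      by (intro positively_spanning_normals[OF gaps, where p = p and q = q and
            k\<^sub>1 = "R * cos ((\<theta> 3 - \<theta> 0) / 2)" and k\<^sub>2 = "R * cos ((\<theta> 5 - \<theta> 2) / 2)" and
            k\<^sub>3 = "R * cos ((\<theta> 7 - \<theta> 4) / 2)"])
        (simp_all add: side_def chord_def m)
  qed
  then consider "\<nexists>p. 0 < side 0 p \<and> 0 < side 2 p \<and> 0 < side 4 p" | "\<nexists>p. 0 < side 1 p \<and> 0 < side 3 p \<and> 0 < side 5 p"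
    by blast
  then show thesis
  proof cases
    case 1
    show thesis by (rule that[of 0]) (use 1 in \<open>simp_all add: numeral_2_eq_2\<close>)
  next
    case 2
    show thesis by (rule that[of 1]) (use 2 in \<open>simp_all add: numeral_3_eq_3\<close>)
  qed
qed

end

section \<open>Line transversals\<close>

theorem theorem2p8:
  fixes I :: "'i set"
    and F :: "'i \<Rightarrow> (real ^ 2) set"
    and indep :: "'i set \<Rightarrow> bool"
  assumes "finite I"
    and "\<And>i. i \<in> I \<Longrightarrow> convex (F i)"
    and "matroid I indep"
    and "matroid_rank indep I = 6"
    and "\<And>T. T \<subseteq> I \<Longrightarrow> card T = 3 \<Longrightarrow> matroid_rank indep T = 3 \<Longrightarrow>
           \<exists>L. is_line L \<and> pierces L (F ` T)"
  shows "\<exists>Ls. card Ls = 3 \<and> (\<forall>L\<in>Ls. is_line L) \<and>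
           (\<exists>J\<subseteq>I. pierces (\<Union>Ls) (F ` J) \<and> matroid_rank indep (I - J) \<le> 5)"
proof (rule ccontr)
  assume not_pierced: "\<not> ?thesis"
  interpret matroid I indep by fact

  \<comment> \<open>Representative points in a common disc\<close>
  define Tr where "Tr = {T. indep T \<and> card T = 3}"
  have finTr: "finite Tr"
    using finite_indep_subsets[of I] indep_subset_carrier
    by (auto simp: Tr_def elim!: rev_finite_subset)
  have "\<forall>T\<in>Tr. \<exists>L. is_line L \<and> pierces L (F ` T)"
    using assms(5) indep_subset_carrier rank_indep by (simp add: Tr_def)
  then obtain L where L: "\<And>T. T \<in> Tr \<Longrightarrow> is_line (L T)" "\<And>T. T \<in> Tr \<Longrightarrow> pierces (L T) (F ` T)"
    by metis
  have "\<exists>p. p \<in> L T \<inter> F C" if "T \<in> Tr" "C \<in> T" for T C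
    using L(2)[OF that(1)] that(2) by (auto simp: pierces_def)
  then obtain pt where pt: "\<And>T C. T \<in> Tr \<Longrightarrow> C \<in> T \<Longrightarrow> pt T C \<in> L T \<inter> F C"
    by metis
  \<comment> \<open>Replacing each set by finitely many of its points makes compactness unnecessary. Sets in no
    independent triple, which may be empty, get the dummy point \<open>0\<close>.\<close>
  define P where "P C = (if \<exists>T\<in>Tr. C \<in> T then (\<lambda>T. pt T C) ` {T \<in> Tr. C \<in> T} else {0})" for C
  have finP: "finite (P C)" and P_ne: "P C \<noteq> {}" for C
    using finTr by (auto simp: P_def)
  \<comment> \<open>\<open>matroid_KKM\<close> has hypotheses on every \<open>C\<close>, so the
    bound also covers indices outside \<open>I\<close>, where \<open>P C\<close> is
    \<open>{0}\<close>.\<close>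
  have "P C \<subseteq> insert 0 (\<Union>C\<in>I. P C)" for C
    using indep_subset_carrier by (auto simp: P_def Tr_def)
  moreover have "bounded (insert 0 (\<Union>C\<in>I. P C))"
    using finP assms(1) by (intro finite_imp_bounded) auto
  then obtain R where "\<And>p. p \<in> insert 0 (\<Union>C\<in>I. P C) \<Longrightarrow> norm p < R"
    unfolding bounded_pos_less by blast
  ultimately have R: "norm p < R" if "p \<in> P C" for p C
    using that by blast

  \<comment> \<open>Angles from the coordinates of a simplex point\<close>
  obtain e :: "nat \<Rightarrow> 6" where e: "bij_betw e {..<6} UNIV"
    using ex_bij_betw_nat_finite[of "UNIV :: 6 set"] by (auto simp: atLeast0LessThan)
  \<comment> \<open>\<open>e\<close> and its inverse \<open>n\<close> translate between the
    coordinates, indexed by a type with six elements, and the arc indices 0 to 5.\<close>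
  define n where "n = inv_into {..<6} e"
  have n_e: "n (e k) = k" if "k < 6" for k
    using bij_betw_inv_into_left[OF e, of k] that by (simp add: n_def)
  have e_n: "e (n i) = i" for i
    using bij_betw_inv_into_right[OF e, of i] by (simp add: n_def)
  have n_less: "n i < 6" for i
    using bij_betw_apply[OF bij_betw_inv_into[OF e], of i] by (simp add: n_def)
  define \<theta> where "\<theta> x k = 2 * pi * (\<Sum>j<k. x $ e (j mod 6))" for x :: "real ^ 6" and k :: nat
  have \<theta>_Suc: "\<theta> x (Suc k) = \<theta> x k + 2 * pi * x $ e (k mod 6)" for x k
    by (simp add: \<theta>_def algebra_simps)
  have angles: "cyclic_angles (\<theta> x)" if x: "x \<in> prob_simplex" for x
  proof
    show "mono (\<theta> x)"
      using prob_simplex_nonneg[OF x] by (simp add: mono_iff_le_Suc \<theta>_Suc)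
    show "\<theta> x (k + 6) = \<theta> x k + 2 * pi" for k
    proof (induction k)
      case 0
      have "(\<Sum>j<6. x $ e (j mod 6)) = (\<Sum>j<6. x $ e j)"
        by (intro sum.cong) auto
      also have "\<dots> = 1"
        using sum.reindex_bij_betw[OF e, of "\<lambda>i. x $ i"] sum_prob_simplex[OF x] by simp
      finally show ?case by (simp add: \<theta>_def)
    next
      case (Suc k)
      then show ?case
        using \<theta>_Suc[of x "k + 6"] \<theta>_Suc[of x k] by (simp add: add.commute)
    qed
  qed

  \<comment> \<open>Wedge functions satisfying the hypotheses of the KKM theorem\<close>
  define h where "h x k = cyclic_angles.side (\<theta> x) R k" for x k
  have h_chord: "h x k = chord R (\<theta> x k) (\<theta> x (k + 3))" if "x \<in> prob_simplex" for x k
    by (simp add: h_def cyclic_angles.side_def[OF angles[OF that]])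
  \<comment> \<open>A product of positive parts is continuous in \<open>x\<close> and positive
    exactly when all points of \<open>P C\<close> lie in the open wedge of arc
    \<open>n i\<close>.\<close>
  define d where "d C i x = (\<Prod>p\<in>P C. max 0 (h x (n i) p) * max 0 (h x (n i + 4) p))" for C i x
  have d_pos_iff: "0 < d C i x \<longleftrightarrow> (\<forall>p\<in>P C. 0 < h x (n i) p \<and> 0 < h x (n i + 4) p)" for C i x
  proof
    assume "0 < d C i x"
    then have "\<forall>p\<in>P C. max 0 (h x (n i) p) * max 0 (h x (n i + 4) p) \<noteq> 0"
      unfolding d_def using finP[of C] by (metis less_irrefl prod_zero_iff)
    then show "\<forall>p\<in>P C. 0 < h x (n i) p \<and> 0 < h x (n i + 4) p"
      by (auto simp: max_def split: if_splits)
  qed (auto simp: d_def intro!: prod_pos)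

  have "continuous_on prob_simplex (d C i)" for C i
  proof -
    have "continuous_on prob_simplex (\<lambda>x. h x k p)" for k p
    proof -
      have "continuous_on prob_simplex (\<lambda>x. chord R (\<theta> x k) (\<theta> x (k + 3)) p)"
        unfolding chord_def \<theta>_def by (intro continuous_intros) auto
      then show ?thesis
        by (rule continuous_on_eq) (simp add: h_chord)
    qed
    then show ?thesis
      unfolding d_def by (intro continuous_intros)
  qed
  moreover have "0 \<le> d C i x" for C i x
    by (simp add: d_def prod_nonneg)
  \<comment> \<open>The wedge of an arc of length 0 contains no point of the disc, and
    \<open>P C\<close> is nonempty, so some factor vanishes.\<close>
  moreover have face: "d C i x = 0" if x: "x \<in> prob_simplex" "x $ i = 0" for C i x
  proof -
    obtain p where p: "p \<in> P C"
      using P_ne by blast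
    have "\<theta> x (Suc (n i)) = \<theta> x (n i)"
      using x(2) by (simp add: \<theta>_Suc e_n n_less)
    then have "\<not> (0 < h x (n i) p \<and> 0 < h x (n i + 4) p)"
      using cyclic_angles.wedge_empty[OF angles[OF x(1)] R[OF p]]
      by (metis h_def linorder_not_less)
    then have "max 0 (h x (n i) p) * max 0 (h x (n i + 4) p) = 0"
      by (auto simp: max_def)
    then show ?thesis
      unfolding d_def using finP p by (intro prod_zero) auto
  qed
  \<comment> \<open>By \<open>not_pierced\<close>, the sets missed by the three chords contain an
    independent six. Each of them lies on one side of every chord, hence its points lie in one
    wedge.\<close>
  moreover have "\<exists>B. indep B \<and> card B = CARD(6) \<and> (\<forall>C\<in>B. \<exists>i. 0 < d C i x)"
    if x: "x \<in> prob_simplex" for x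
  proof -
    interpret cyclic_angles "\<theta> x" R
      by (rule angles[OF x])
    define A where "A = (\<lambda>k. {p. h x k p = 0}) ` {..<3}"
    have "card A \<le> 3"
      using card_image_le[of "{..<3::nat}" "\<lambda>k. {p. h x k p = 0}"] by (simp add: A_def)
    moreover have "\<forall>L\<in>A. is_line L"
      using is_line_chord by (auto simp: A_def h_chord[OF x])
    ultimately obtain Ls where Ls: "A \<subseteq> Ls" "card Ls = 3" "\<forall>L\<in>Ls. is_line L"
      using three_lines_superset[of A] by (auto simp: A_def)
    define J where "J = {C \<in> I. \<Union>Ls \<inter> F C \<noteq> {}}"
    have "pierces (\<Union>Ls) (F ` J)"
      by (auto simp: J_def pierces_def)
    moreover have "J \<subseteq> I"
      by (auto simp: J_def)
    ultimately have "\<not> matroid_rank indep (I - J) \<le> 5"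
      using not_pierced Ls(2,3) by blast
    then have "6 \<le> matroid_rank indep (I - J)"
      by simp
    then obtain X where X: "X \<subseteq> I - J" "indep X" "6 \<le> card X"
      using rank_attained[of "I - J"] by metis
    then obtain B where B: "B \<subseteq> X" "card B = 6"
      using obtain_subset_with_card_n by metis
    then have indB: "indep B"
      using X(2) indep_subset by blast
    have "\<exists>i. 0 < d C i x" if C: "C \<in> B" for C
    proof -
      \<comment> \<open>Two more elements of \<open>B\<close> complete \<open>C\<close> to an
        independent triple, so \<open>P C\<close> consists of points of \<open>F C\<close> and not
        of the dummy.\<close>
      have "2 \<le> card (B - {C})"
        using B C by simp
      then obtain S where S: "S \<subseteq> B - {C}" "card S = 2"
        using obtain_subset_with_card_n by metis
      then have "insert C S \<in> Tr"
        using C indB indep_subset[of B "insert C S"] finite_subset[OF S(1)] indep_finite[OF indB]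
        by (auto simp: Tr_def card_insert_if)
      then have "P C \<subseteq> F C"
        using pt by (auto simp: P_def)
      have C': "C \<in> I" "\<Union>Ls \<inter> F C = {}"
        using C B(1) X(1) by (auto simp: J_def)
      have "(\<forall>p\<in>P C. 0 < h x k p) \<or> (\<forall>p\<in>P C. h x k p < 0)" if "k < 3" for k
      proof -
        have "F C \<inter> {p. h x k p = 0} = {}"
          using C'(2) Ls(1) that by (auto simp: A_def)
        then show ?thesis
          using chord_constant_sign[OF assms(2)[OF C'(1)]] \<open>P C \<subseteq> F C\<close>
          unfolding h_chord[OF x] by blast
      qed
      then obtain k where "k < 6" "\<forall>p\<in>P C. 0 < h x k p \<and> 0 < h x (k + 4) p"
        using sign_pattern_in_wedge[of "P C"] unfolding h_def by blast
      then have "0 < d C (e k) x"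
        by (simp add: d_pos_iff n_e)
      then show ?thesis by blast
    qed
    then show ?thesis
      using indB B(2) by auto
  qed

  \<comment> \<open>An alternating independent triple without a line transversal\<close>
  ultimately obtain x c where x: "x \<in> prob_simplex" and c: "inj c" "indep (range c)"
    and dpos: "\<forall>i. 0 < d (c i) i x"
    by (rule matroid_KKM) blast
  interpret cyclic_angles "\<theta> x" R
    by (rule angles[OF x])
  have wedge: "0 < h x k p" "0 < h x (k + 4) p" if "k < 6" "p \<in> P (c (e k))" for k p
    using spec[OF dpos, of "e k"] that by (auto simp: d_pos_iff n_e)
  \<comment> \<open>A zero coordinate would force the corresponding \<open>d\<close> to vanish;
    hence all six arcs are nondegenerate.\<close>
  have "0 < x $ i" for i
    using face[OF x, of i "c i"] spec[OF dpos, of i] prob_simplex_nonneg[OF x, of i] by (auto simp: less_le)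
  then have "\<theta> x k < \<theta> x (Suc k)" for k
    by (simp add: \<theta>_Suc)
  \<comment> \<open>\<open>s\<close> selects an alternating triple of wedges with no common
    point.\<close>
  then obtain s where "s < 2" "\<nexists>p. 0 < side s p \<and> 0 < side (s + 2) p \<and> 0 < side (s + 4) p"
    by (rule central_triangle_one_sided) blast
  then have s: "s < 2" "\<nexists>p. 0 < h x s p \<and> 0 < h x (s + 2) p \<and> 0 < h x (s + 4) p"
    by (simp_all add: h_def)
  define T where "T = {c (e s), c (e (s + 2)), c (e (s + 4))}"
  have "inj_on e {s, s + 2, s + 4}"
    by (rule inj_on_subset[OF bij_betw_imp_inj_on[OF e]]) (use s(1) in auto)
  then have "inj_on (c \<circ> e) {s, s + 2, s + 4}"
    by (rule comp_inj_on) (rule inj_on_subset[OF c(1) subset_UNIV])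
  then have "card T = card {s, s + 2, s + 4}"
    using card_image[of "c \<circ> e" "{s, s + 2, s + 4}"] by (simp add: T_def)
  then have "T \<in> Tr"
    using c(2) indep_subset[of "range c" T] by (auto simp: T_def Tr_def)
  \<comment> \<open>The points in which the line assigned to \<open>T\<close> meets its three sets;
    by construction they are among the representative points and so lie in the wedges.\<close>
  define a where "a k = pt T (c (e k))" for k
  have aL: "a k \<in> L T" and aP: "a k \<in> P (c (e k))" if "k \<in> {s, s + 2, s + 4}" for k
  proof -
    have "c (e k) \<in> T"
      using that by (auto simp: T_def)
    then show "a k \<in> L T" "a k \<in> P (c (e k))"
      using pt \<open>T \<in> Tr\<close> by (auto simp: a_def P_def)
  qed
  \<comment> \<open>The second sides of wedges \<open>s + 2\<close> and \<open>s + 4\<close> have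
    indices \<open>s + 6\<close> and \<open>s + 8\<close>, which reduce to \<open>s\<close> and
    \<open>s + 2\<close>. Each point is thus positive on two of the three sides \<open>s\<close>,
    \<open>s + 2\<close>, \<open>s + 4\<close>.\<close>
  have "0 < h x s (a (s + 2))" "0 < h x (s + 2) (a (s + 4))"
    using wedge(2)[OF _ aP, of "s + 2"] wedge(2)[OF _ aP, of "s + 4"] s(1)
      side_shift6[of s "a (s + 2)"] side_shift6[of "s + 2" "a (s + 4)"]
    by (simp_all add: h_def add.commute)
  then have in_wedge: "0 < h x s (a s)" "0 < h x (s + 4) (a s)" "0 < h x s (a (s + 2))"
    "0 < h x (s + 2) (a (s + 2))" "0 < h x (s + 4) (a (s + 4))" "0 < h x (s + 2) (a (s + 4))"
    using wedge[OF _ aP] s(1) by auto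
  have "\<not> collinear {a (s + 4), a (s + 2), a s}"
  proof (rule three_wedges_not_collinear)
    show "\<nexists>p. 0 < chord R (\<theta> x (s + 4)) (\<theta> x (s + 4 + 3)) p \<and> 0 < chord R (\<theta> x (s + 2)) (\<theta> x (s + 2 + 3)) p
        \<and> 0 < chord R (\<theta> x s) (\<theta> x (s + 3)) p"
      using s(2) unfolding h_chord[OF x] by blast
  qed (use in_wedge in \<open>simp_all only: h_chord[OF x]\<close>)
  moreover have "collinear {a (s + 4), a (s + 2), a s}"
  proof (rule collinear_subset)
    show "collinear (L T)"
      using L(1)[OF \<open>T \<in> Tr\<close>] by (simp add: collinear_aff_dim is_line_def)
  qed (use aL in auto)
  ultimately show False by simp
qed

end
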